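(* Let $\mathcal{H}$ be a finite hypergraph of rank $r$. Then the simplicial complex $$\mathrm{Int}_{\mathcal{H}}=\{\mathcal{F}\subset\mathcal{H}:\ A\cap B\neq\emptyset\text{ for all }A,B\in\mathcal{F}\}$$ is $\frac12\binom{2r}{r}$-collapsible.
   Context: A hypergraph $\mathcal{H}$ is identified with its edge set (a collection of finite sets, the edges); subsets $\mathcal{F}\subset\mathcal{H}$ are again hypergraphs. The rank of $\mathcal{H}$ is the maximal size of an edge of $\mathcal{H}$. The vertices of $\mathrm{Int}_{\mathcal{H}}$ are edges of $\mathcal{H}$ and its simplices are the pairwise intersecting sub-hypergraphs. Simplicial complexes are finite abstract simplicial complexes (families of finite sets closed under taking subsets); a non-void complex contains the empty simplex, and the void complex $\emptyset$ has no simplices at all (so it differs from $\{\emptyset\}$). Let $X$ be a finite simplicial complex, and let $\eta\in X$ be a simplex (possibly empty) such that $|\eta|\le d$ and $\eta$ is contained in a unique maximal face $\tau$ of $X$. The complex $X'=X\setminus\{\sigma\in X:\ \eta\subset\sigma\subset\tau\}$ is said to be obtained from $X$ by an elementary $d$-collapse. $X$ is $d$-collapsible if there is a finite sequence of elementary $d$-collapses from $X$ to the void complex. *)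

theory Defs
  imports Main
begin

section \<open>Hypergraphs\<close>

definition finite_hypergraph :: "'a set set \<Rightarrow> bool" where
  "finite_hypergraph H \<longleftrightarrow> finite H \<and> (\<forall>A\<in>H. finite A)"

text \<open>The \<open>insert 0\<close> only matters for the hypergraph without edges, which gets rank 0.\<close>

definition hypergraph_rank :: "'a set set \<Rightarrow> nat" where
  "hypergraph_rank H = Max (insert 0 (card ` H))"

text \<open>The case \<open>A = B\<close> is not excluded, so an empty edge of \<open>H\<close> belongs to no simplex.\<close>

definition Int_complex :: "'a set set \<Rightarrow> 'a set set set" where
  "Int_complex H = {F. F \<subseteq> H \<and> (\<forall>A\<in>F. \<forall>B\<in>F. A \<inter> B \<noteq> {})}"

section \<open>Collapsibility of simplicial complexes\<close>

text \<open>The void complex \<open>{}\<close> is allowed; it differs from \<open>{{}}\<close>, whose only simplex is the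
  empty one.\<close>

definition finite_simplicial_complex :: "'v set set \<Rightarrow> bool" where
  "finite_simplicial_complex X \<longleftrightarrow>
     finite X \<and> (\<forall>\<sigma>\<in>X. finite \<sigma>) \<and> (\<forall>\<sigma>\<in>X. \<forall>\<rho>. \<rho> \<subseteq> \<sigma> \<longrightarrow> \<rho> \<in> X)"

definition maximal_face :: "'v set set \<Rightarrow> 'v set \<Rightarrow> bool" where
  "maximal_face X \<tau> \<longleftrightarrow> \<tau> \<in> X \<and> (\<forall>\<sigma>\<in>X. \<tau> \<subseteq> \<sigma> \<longrightarrow> \<sigma> = \<tau>)"

definition elementary_collapse :: "nat \<Rightarrow> 'v set set \<Rightarrow> 'v set set \<Rightarrow> bool" where
  "elementary_collapse d X X' \<longleftrightarrow>
     finite_simplicial_complex X \<and>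
     (\<exists>\<eta>\<in>X. \<exists>\<tau>. card \<eta> \<le> d \<and>
        maximal_face X \<tau> \<and> \<eta> \<subseteq> \<tau> \<and>
        (\<forall>\<tau>'. maximal_face X \<tau>' \<and> \<eta> \<subseteq> \<tau>' \<longrightarrow> \<tau>' = \<tau>) \<and>
        X' = X - {\<sigma>\<in>X. \<eta> \<subseteq> \<sigma> \<and> \<sigma> \<subseteq> \<tau>})"

definition collapsible :: "nat \<Rightarrow> 'v set set \<Rightarrow> bool" where
  "collapsible d X \<longleftrightarrow>
     finite_simplicial_complex X \<and> (elementary_collapse d)\<^sup>*\<^sup>* X {}"

text \<open>Halving a central binomial coefficient in \<open>nat\<close> is exact for \<open>r > 0\<close>. For \<open>r = 0\<close> it
  yields 0 instead of 1/2, which does not affect bounds on cardinalities.\<close>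

lemma two_times_half_central_binomial:
  assumes "r > 0"
  shows "2 * ((2 * r choose r) div 2) = (2 * r choose r)"
proof -
  obtain k where k: "r = Suc k"
    using assms by (cases r) auto
  have "(Suc (2 * k + 1) choose Suc k) = (2 * k + 1 choose k) + (2 * k + 1 choose Suc k)"
    by simp
  moreover have "(2 * k + 1 choose k) = (2 * k + 1 choose Suc k)"
    using binomial_symmetric[of k "2 * k + 1"] by simp
  ultimately have "even (2 * r choose r)"
    using k by simp
  then show ?thesis
    by simp
qed

end

theory Submission
  imports Defs Complex_Main "HOL-Library.Multiset" "HOL-Computational_Algebra.Polynomial"
begin

text \<open>
  The proof separates a topological part, valid for every simplicial complex, from an extremal
  bound on set systems.

  \<^emph>\<open>Topology.\<close> Let \<open>G\<close> be a set of faces that generates a complex, such as its maximal faces.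
  Remove from the complex, one member of \<open>G\<close> at a time, all the faces that lie in the current member but in none of the later
  ones. The faces to be removed form a set \<open>{\<sigma>. \<eta> \<subseteq> \<sigma> \<subseteq> T, \<sigma> escapes every later member}\<close> with
  \<open>\<eta> = {}\<close>, and such a set is split recursively: a face which contains \<open>\<eta>\<close> and escapes a later
  member \<open>F \<supseteq> \<eta>\<close> has some vertex in \<open>T - F\<close>. For a chosen \<open>v\<close> in \<open>T - F\<close>, it either contains
  \<open>v\<close>, which is then added to \<open>\<eta>\<close>, or avoids it, and then \<open>v\<close> is dropped from \<open>T\<close>. When no
  later member is left, the set is an interval \<open>[\<eta>, T]\<close>, and removing it is an elementary
  \<open>|\<eta>|\<close>-collapse. The vertices in \<open>\<eta>\<close> form what is called an exclusion sequence here: each new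
  vertex misses a member of \<open>G\<close> that contains all the previous ones. Hence a complex is
  \<open>d\<close>-collapsible if the exclusion sequences contained in a face have length at most \<open>d\<close>
  (\<open>collapsible_if_exclusion_seq_bounded\<close>).

  \<^emph>\<open>Extremal bound.\<close> In the complex of intersecting families, an edge \<open>A\<^sub>i\<close> missing from a
  maximal family is disjoint from some edge \<open>B\<^sub>i\<close> of that family, whereas \<open>B\<^sub>i\<close> meets every
  edge of the family, in particular the previous edges of the exclusion sequence
  \<open>A\<^sub>1, \<dots>, A\<^sub>m\<close>. As the \<open>A\<^sub>i\<close> also meet each other, the \<open>2m\<close> pairs
  \<open>(A\<^sub>1, B\<^sub>1), \<dots>, (A\<^sub>m, B\<^sub>m), (B\<^sub>m, A\<^sub>m), \<dots>, (B\<^sub>1, A\<^sub>1)\<close> are disjoint pairs in which the first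
  set of a pair meets the second set of every later pair. The skew version of the Bollobas
  theorem on set pairs (\<open>skew_Bollobas\<close>) gives \<open>2m \<le> (2r choose r)\<close>; using every pair in both
  orders is what yields the factor one half.

  The skew theorem is proved by the polynomial method. With the points embedded into the reals,
  \<open>\<Prod>x\<in>A. \<Prod>y\<in>B. (x - y)\<close> vanishes iff \<open>A\<close> meets \<open>B\<close>, and it is the value of a form of degree
  \<open>|A|\<close>, depending only on \<open>A\<close>, at the \<open>|B| + 1\<close> coefficients of the polynomial with root set
  \<open>B\<close>. So a triangular matrix with nonzero diagonal factors through the space of such forms.
\<close>

section \<open>Collapsing by exclusion sequences\<close>

text \<open>The head of the list is the vertex added last.\<close>

inductive exclusion_seq :: "'v set set \<Rightarrow> 'v list \<Rightarrow> bool" for G where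
  Nil: "exclusion_seq G []"
| Cons: "exclusion_seq G (v # vs)"
  if "exclusion_seq G vs" "F \<in> G" "set vs \<subseteq> F" "v \<notin> F"

definition escaping_interval :: "'v set \<Rightarrow> 'v set \<Rightarrow> 'v set set \<Rightarrow> 'v set set" where
  "escaping_interval \<eta> T L = {\<sigma>. \<eta> \<subseteq> \<sigma> \<and> \<sigma> \<subseteq> T \<and> (\<forall>F\<in>L. \<not> \<sigma> \<subseteq> F)}"

lemma finite_simplicial_complex_Diff:
  assumes "finite_simplicial_complex X"
    and "\<And>\<sigma> \<rho>. \<sigma> \<in> U \<Longrightarrow> \<sigma> \<subseteq> \<rho> \<Longrightarrow> \<rho> \<in> X \<Longrightarrow> \<rho> \<in> U"
  shows "finite_simplicial_complex (X - U)"
  unfolding finite_simplicial_complex_def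
proof (intro conjI ballI allI impI)
  show "\<rho> \<in> X - U" if "\<sigma> \<in> X - U" "\<rho> \<subseteq> \<sigma>" for \<sigma> \<rho>
    using that assms(1) assms(2)[of \<rho> \<sigma>] unfolding finite_simplicial_complex_def by blast
qed (use assms(1) in \<open>auto simp: finite_simplicial_complex_def\<close>)

text \<open>
  The last hypothesis says that the part of \<open>X\<close> to be removed is an up-set of \<open>X\<close> and, apart
  from the constraints in \<open>L\<close>, looks like the full interval \<open>[set vs, T]\<close>. It survives both
  branches of the recursion. This is where the order of the branches matters: the faces
  containing \<open>v\<close> are removed first, after which no escaping face above \<open>set vs\<close> contains \<open>v\<close>,
  so that \<open>T\<close> may be replaced by \<open>T - {v}\<close>. Faces containing \<open>v\<close> that do lie in a member of
  \<open>L\<close> may remain in \<open>X\<close>; they do no harm, because at the end of the recursion \<open>set vs\<close> lies in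
  no member of the original list.
\<close>

lemma exclusion_collapse:
  assumes bound: "\<And>vs. exclusion_seq G vs \<Longrightarrow> set vs \<subseteq> M \<Longrightarrow> length vs \<le> d"
    and "finite_simplicial_complex X" and "set L \<subseteq> G" and "exclusion_seq G vs"
    and "set vs \<subseteq> T" and "T \<subseteq> M" and "finite T"
    and "X \<inter> escaping_interval (set vs) UNIV (set L) = escaping_interval (set vs) T (set L)"
  shows "(elementary_collapse d)\<^sup>*\<^sup>* X (X - escaping_interval (set vs) T (set L))"
  using assms(2-)
proof (induction L arbitrary: X vs T)
  case Nil
  \<comment> \<open>Without constraints the faces above \<open>?\<eta>\<close> are exactly the interval \<open>[?\<eta>, T]\<close>.\<close>
  let ?\<eta> = "set vs"
  have above: "\<sigma> \<subseteq> T" if "\<sigma> \<in> X" "?\<eta> \<subseteq> \<sigma>" for \<sigma>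
    using Nil.prems(7) that by (auto simp: escaping_interval_def)
  have between: "\<sigma> \<in> X" if "?\<eta> \<subseteq> \<sigma>" "\<sigma> \<subseteq> T" for \<sigma>
    using Nil.prems(7) that by (auto simp: escaping_interval_def)
  have "card ?\<eta> \<le> d"
    using bound[of vs] Nil.prems card_length[of vs] by (meson order_trans)
  moreover have "maximal_face X T"
    using above between[of T] Nil.prems(4) unfolding maximal_face_def by blast
  moreover have "\<tau> = T" if "maximal_face X \<tau>" "?\<eta> \<subseteq> \<tau>" for \<tau>
    using above[of \<tau>] between[of T] that Nil.prems(4) unfolding maximal_face_def by blast
  moreover have "X - escaping_interval ?\<eta> T (set []) = X - {\<sigma>\<in>X. ?\<eta> \<subseteq> \<sigma> \<and> \<sigma> \<subseteq> T}"
    by (auto simp: escaping_interval_def)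
  ultimately have "elementary_collapse d X (X - escaping_interval ?\<eta> T (set []))"
    unfolding elementary_collapse_def
    using between[of ?\<eta>] Nil.prems(1,4) by blast
  then show ?case by blast
next
  case (Cons F L)
  show ?case
  proof (cases "set vs \<subseteq> F")
    case False
    then have "escaping_interval (set vs) S (set (F # L)) = escaping_interval (set vs) S (set L)" for S
      by (auto simp: escaping_interval_def)
    then show ?thesis
      using Cons.IH[of X vs T] Cons.prems by simp
  next
    case True
    \<comment> \<open>The constraint \<open>F\<close> is resolved by branching on the vertices of \<open>T - F\<close> one by one.\<close>
    from Cons.prems(6) Cons.prems(1,4,5,7) show ?thesis
    proof (induction T arbitrary: X rule: finite_psubset_induct)
      case (psubset T)
      show ?case
      proof (cases "T \<subseteq> F")
        case True
        then have "escaping_interval (set vs) T (set (F # L)) = {}"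
          by (auto simp: escaping_interval_def)
        then show ?thesis by simp
      next
        case False
        then obtain v where v: "v \<in> T" "v \<notin> F" by blast
        let ?U = "escaping_interval (set (v # vs)) T (set L)"
        let ?X = "X - ?U"
        have iff: "\<sigma> \<in> X \<longleftrightarrow> \<sigma> \<subseteq> T"
          if "set vs \<subseteq> \<sigma>" "\<forall>F'\<in>set (F # L). \<not> \<sigma> \<subseteq> F'" for \<sigma>
          using psubset.prems(4) that unfolding escaping_interval_def by blast
        have "(elementary_collapse d)\<^sup>*\<^sup>* X ?X"
        proof (rule Cons.IH)
          show "exclusion_seq G (v # vs)"
            using Cons.prems(2,3) \<open>set vs \<subseteq> F\<close> v(2) by (auto intro: exclusion_seq.Cons)
          show "X \<inter> escaping_interval (set (v # vs)) UNIV (set L) = ?U"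
            using iff v unfolding escaping_interval_def by auto
          show "set L \<subseteq> G" using Cons.prems(2) by simp
          show "set (v # vs) \<subseteq> T" using psubset.prems(2) v(1) by simp
        qed (fact psubset)+
        moreover have "finite_simplicial_complex ?X"
        proof (rule finite_simplicial_complex_Diff[OF psubset.prems(1)])
          fix \<sigma> \<rho> assume "\<sigma> \<in> ?U" "\<sigma> \<subseteq> \<rho>" "\<rho> \<in> X"
          then have "insert v (set vs) \<subseteq> \<rho> \<and> (\<forall>F'\<in>set L. \<not> \<rho> \<subseteq> F')"
            unfolding escaping_interval_def list.set by (blast intro: subset_trans)
          then show "\<rho> \<in> ?U"
            using iff[of \<rho>] v(2) \<open>\<rho> \<in> X\<close> unfolding escaping_interval_def by auto
        qed
        moreover from this have "(elementary_collapse d)\<^sup>*\<^sup>* ?X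
            (?X - escaping_interval (set vs) (T - {v}) (set (F # L)))"
        proof (rule psubset.IH[rotated])
          show "T - {v} \<subset> T" using v(1) by blast
          show "T - {v} \<subseteq> M" using psubset.prems(3) by blast
          show "set vs \<subseteq> T - {v}"
            using psubset.prems(2) \<open>set vs \<subseteq> F\<close> v(2) by blast
          show "?X \<inter> escaping_interval (set vs) UNIV (set (F # L))
              = escaping_interval (set vs) (T - {v}) (set (F # L))"
            using iff unfolding escaping_interval_def by auto
        qed
        moreover have "?X - escaping_interval (set vs) (T - {v}) (set (F # L))
            = X - escaping_interval (set vs) T (set (F # L))"
          using v unfolding escaping_interval_def by auto
        ultimately show ?thesis by (metis rtranclp_trans)
      qed
    qed
  qed
qed

text \<open>
  Deleting the faces that lie in the head of a list of generating faces and in no other member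
  of it leaves the complex generated by the tail.
\<close>

theorem collapsible_if_exclusion_seq_bounded:
  assumes fin: "finite G" "\<And>F. F \<in> G \<Longrightarrow> finite F"
    and X: "X = {\<sigma>. \<exists>F\<in>G. \<sigma> \<subseteq> F}"
    and bound: "\<And>vs F. exclusion_seq G vs \<Longrightarrow> F \<in> G \<Longrightarrow> set vs \<subseteq> F \<Longrightarrow> length vs \<le> d"
  shows "collapsible d X"
proof -
  define gen where "gen L = {\<sigma>. \<exists>F\<in>set L. \<sigma> \<subseteq> F}" for L :: "'a set list"
  have fsc: "finite_simplicial_complex (gen L)" if "set L \<subseteq> G" for L
  proof -
    have "gen L = \<Union> (Pow ` set L)" by (auto simp: gen_def)
    then have "finite (gen L)" using fin(2) that by auto
    moreover have "finite \<sigma>" if "\<sigma> \<in> gen L" for \<sigma>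
      using that fin(2) \<open>set L \<subseteq> G\<close> finite_subset unfolding gen_def by blast
    ultimately show ?thesis
      unfolding finite_simplicial_complex_def gen_def by blast
  qed
  have "(elementary_collapse d)\<^sup>*\<^sup>* (gen L) {}" if "set L \<subseteq> G" for L
    using that
  proof (induction L)
    case Nil
    then show ?case by (simp add: gen_def)
  next
    case (Cons F L)
    have "(elementary_collapse d)\<^sup>*\<^sup>* (gen (F # L))
        (gen (F # L) - escaping_interval (set []) F (set L))"
    proof (rule exclusion_collapse[where M = F and G = G])
      show "gen (F # L) \<inter> escaping_interval (set []) UNIV (set L)
          = escaping_interval (set []) F (set L)"
        by (auto simp: gen_def escaping_interval_def)
      show "length vs \<le> d" if "exclusion_seq G vs" "set vs \<subseteq> F" for vs
        using bound[of vs F] that Cons.prems by simp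
      show "finite_simplicial_complex (gen (F # L))"
        using fsc Cons.prems by blast
    qed (use Cons.prems fin(2) in \<open>simp_all add: exclusion_seq.Nil\<close>)
    moreover have "gen (F # L) - escaping_interval (set []) F (set L) = gen L"
      by (auto simp: gen_def escaping_interval_def)
    ultimately show ?case using Cons by auto
  qed
  moreover obtain L where "set L = G" using finite_list[OF fin(1)] by blast
  ultimately show ?thesis
    using fsc[of L] unfolding collapsible_def X gen_def by auto
qed

section \<open>The skew Bollobas theorem\<close>

text \<open>Gaussian elimination for a homogeneous linear system with one equation for each element of
  \<open>K\<close> and one unknown for each element of \<open>I\<close>.\<close>

lemma nontrivial_solution:
  fixes u :: "'i \<Rightarrow> 'k \<Rightarrow> 'f :: field"
  assumes "finite K" "finite I" "card K < card I"
  shows "\<exists>x. (\<exists>i\<in>I. x i \<noteq> 0) \<and> (\<forall>k\<in>K. (\<Sum>i\<in>I. x i * u i k) = 0)"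
  using assms
proof (induction K arbitrary: I u rule: finite_induct)
  case empty
  then have "I \<noteq> {}" by auto
  then show ?case by (intro exI[of _ "\<lambda>_. 1"]) auto
next
  case (insert k K)
  show ?case
  proof (cases "\<forall>i\<in>I. u i k = 0")
    case True
    then show ?thesis using insert.IH[of I u] insert.prems insert.hyps by auto
  next
    case False
    then obtain p where p: "p \<in> I" "u p k \<noteq> 0" by blast
    let ?J = "I - {p}"
    \<comment> \<open>Equation \<open>k\<close> is solved for the unknown \<open>p\<close>, which is then eliminated from the others.\<close>
    define w where "w i l = u i l - u i k / u p k * u p l" for i l
    have "card K < card ?J"
      using insert.prems insert.hyps p(1) by simp
    then obtain x where x: "\<exists>i\<in>?J. x i \<noteq> 0" "\<And>l. l \<in> K \<Longrightarrow> (\<Sum>i\<in>?J. x i * w i l) = 0"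
      using insert.IH[of ?J w] insert.prems by auto
    define y where "y = x(p := - (\<Sum>i\<in>?J. x i * u i k) / u p k)"
    have key: "(\<Sum>i\<in>I. y i * u i l) = (\<Sum>i\<in>?J. x i * w i l)" for l
    proof -
      have "(\<Sum>i\<in>I. y i * u i l) = y p * u p l + (\<Sum>i\<in>?J. x i * u i l)"
        using insert.prems(1) p(1) by (simp add: sum.remove y_def)
      also have "y p * u p l = - (\<Sum>i\<in>?J. x i * (u i k / u p k * u p l))"
        by (simp add: y_def sum_distrib_right sum_divide_distrib mult.assoc)
      also have "\<dots> + (\<Sum>i\<in>?J. x i * u i l) = (\<Sum>i\<in>?J. x i * w i l)"
        by (simp add: w_def right_diff_distrib sum_subtractf)
      finally show ?thesis .
    qed
    have "(\<Sum>i\<in>I. y i * u i k) = 0"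
      unfolding key by (rule sum.neutral) (simp add: w_def p(2))
    moreover have "\<exists>i\<in>I. y i \<noteq> 0"
      using x(1) by (auto simp: y_def)
    ultimately show ?thesis
      using x(2) by (intro exI[of _ y]) (auto simp: key)
  qed
qed

text \<open>An \<open>m \<times> m\<close> matrix that is triangular with nonzero diagonal has rank \<open>m\<close>, but a product of
  an \<open>m \<times> K\<close> and a \<open>K \<times> m\<close> matrix has rank at most \<open>|K|\<close>.\<close>

lemma triangular_factorization_bound:
  fixes M :: "nat \<Rightarrow> nat \<Rightarrow> 'f :: field"
  assumes fac: "\<And>i j. i < m \<Longrightarrow> j < m \<Longrightarrow> M i j = (\<Sum>k\<in>K. u i k * w j k)"
    and diag: "\<And>i. i < m \<Longrightarrow> M i i \<noteq> 0"
    and tri: "\<And>i j. i < j \<Longrightarrow> j < m \<Longrightarrow> M i j = 0"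
    and "finite K"
  shows "m \<le> card K"
proof (rule ccontr)
  assume "\<not> m \<le> card K"
  then obtain x where ex: "\<exists>i<m. x i \<noteq> 0"
    and x: "\<And>k. k \<in> K \<Longrightarrow> (\<Sum>i<m. x i * u i k) = 0"
    using nontrivial_solution[of K "{..<m}" u] \<open>finite K\<close> by auto
  \<comment> \<open>In column \<open>j\<close> of the dependency only the diagonal entry can contribute: above it the matrix
    vanishes, below it the coefficients do.\<close>
  define j where "j = Max {i. i < m \<and> x i \<noteq> 0}"
  have "j \<in> {i. i < m \<and> x i \<noteq> 0}"
    unfolding j_def using ex by (intro Max_in) auto
  then have j: "j < m" "x j \<noteq> 0" by auto
  have beyond: "x i = 0" if "i < m" "j < i" for i
  proof (rule ccontr)
    assume "x i \<noteq> 0"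
    then have "i \<le> j" unfolding j_def using that(1) by (intro Max_ge) auto
    then show False using that(2) by simp
  qed
  have "(\<Sum>i<m. x i * M i j) = (\<Sum>i<m. \<Sum>k\<in>K. x i * u i k * w j k)"
    using fac j(1) by (simp add: sum_distrib_left mult.assoc)
  also have "\<dots> = (\<Sum>k\<in>K. (\<Sum>i<m. x i * u i k) * w j k)"
    by (subst sum.swap) (simp add: sum_distrib_right)
  also have "\<dots> = 0" using x by simp
  finally have "(\<Sum>i<m. x i * M i j) = 0" .
  moreover have "(\<Sum>i<m. x i * M i j) = x j * M j j"
  proof (rule sum.remove[THEN trans])
    show "x j * M j j + (\<Sum>i\<in>{..<m} - {j}. x i * M i j) = x j * M j j"
      using beyond tri j(1) by (auto intro!: sum.neutral) (metis linorder_neqE_nat)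
  qed (use j in auto)
  ultimately show False using j diag by simp
qed

text \<open>
  A product of \<open>n\<close> linear forms in the variables \<open>c 0, \<dots>, c b\<close> is a linear combination of the
  monomials of degree \<open>n\<close>. A monomial is represented by the multiset of the indices of its
  factors, so that the number of monomials is known from the number of multisets of given size.
\<close>

lemma prod_linear_forms_expansion:
  fixes ts :: "'f :: comm_ring_1 multiset"
  shows "\<exists>u. \<forall>c. (\<Prod>t\<in>#ts. \<Sum>k\<le>b. c k * t ^ k)
    = (\<Sum>K\<in>multisets_of_size {..b} (size ts). u K * (\<Prod>k\<in>#K. c k))"
proof (induction ts)
  case empty
  have "multisets_of_size {..b} 0 = {{#}}" by (auto simp: multisets_of_size_def)
  then show ?case by (intro exI[of _ "\<lambda>_. 1"]) simp
next
  case (add t ts)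
  let ?M = "multisets_of_size {..b}"
  let ?S = "{..b} \<times> ?M (size ts)"
  from add.IH obtain u where
    u: "\<And>c. (\<Prod>t\<in>#ts. \<Sum>k\<le>b. c k * t ^ k) = (\<Sum>K\<in>?M (size ts). u K * (\<Prod>k\<in>#K. c k))"
    by blast
  define g where "g = (\<lambda>(k :: nat, K). add_mset k K)"
  define u' where "u' K' = (\<Sum>p\<in>{p\<in>?S. g p = K'}. t ^ fst p * u (snd p))" for K'
  have "(\<Prod>t\<in>#add_mset t ts. \<Sum>k\<le>b. c k * t ^ k)
      = (\<Sum>K\<in>?M (size (add_mset t ts)). u' K * (\<Prod>k\<in>#K. c k))" for c
  proof -
    have "(\<Prod>t\<in>#add_mset t ts. \<Sum>k\<le>b. c k * t ^ k)
        = (\<Sum>p\<in>?S. t ^ fst p * u (snd p) * (\<Prod>k\<in>#g p. c k))"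
      by (simp add: u sum_product sum.cartesian_product g_def case_prod_beta mult_ac)
    also have "\<dots> = (\<Sum>K\<in>?M (Suc (size ts)).
        \<Sum>p\<in>{p\<in>?S. g p = K}. t ^ fst p * u (snd p) * (\<Prod>k\<in>#g p. c k))"
    proof (rule sum.group[symmetric])
      show "g ` ?S \<subseteq> ?M (Suc (size ts))"
        by (auto simp: g_def multisets_of_size_def)
    qed (simp_all add: finite_multisets_of_size)
    also have "\<dots> = (\<Sum>K\<in>?M (Suc (size ts)). u' K * (\<Prod>k\<in>#K. c k))"
      by (intro sum.cong refl) (auto simp: u'_def sum_distrib_right intro!: sum.cong)
    finally show ?thesis by simp
  qed
  then show ?case by blast
qed

text \<open>
  Entry \<open>M i j\<close> of the matrix used below is \<open>\<Prod>x\<in>A i. \<Prod>y\<in>B j. (\<phi> x - \<phi> y)\<close>, up to a nonzero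
  factor that makes it homogeneous of degree exactly \<open>a\<close> in the coefficients of the polynomial
  \<open>p j\<close> with root set \<open>\<phi> ` B j\<close>.
\<close>

theorem skew_Bollobas:
  fixes ps :: "('a set \<times> 'a set) list"
  assumes size: "\<And>A B. (A, B) \<in> set ps \<Longrightarrow> finite A \<and> card A \<le> a \<and> finite B \<and> card B \<le> b"
    and disj: "\<And>A B. (A, B) \<in> set ps \<Longrightarrow> A \<inter> B = {}"
    and meet: "sorted_wrt (\<lambda>(A, B) (A', B'). A \<inter> B' \<noteq> {}) ps"
  shows "length ps \<le> (a + b) choose a"
proof -
  define A where "A i = fst (ps ! i)" for i
  define B where "B i = snd (ps ! i)" for i
  let ?m = "length ps"
  have in_ps: "(A i, B i) \<in> set ps" if "i < ?m" for i
    using that by (simp add: A_def B_def)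
  have fin: "finite (A i)" "finite (B i)" and card: "card (A i) \<le> a" "card (B i) \<le> b"
    if "i < ?m" for i
    using size[OF in_ps[OF that]] by auto
  have meetAB: "A i \<inter> B j \<noteq> {}" if "i < j" "j < ?m" for i j
    using sorted_wrt_nth_less[OF meet that] by (simp add: A_def B_def case_prod_beta)
  define V where "V = (\<Union>i<?m. A i \<union> B i)"
  have "finite V" using fin by (auto simp: V_def)
  then obtain f :: "'a \<Rightarrow> nat" where f: "inj_on f V"
    using finite_imp_inj_to_nat_seg by blast
  define \<phi> where "\<phi> x = real (f x)" for x
  have inj: "\<phi> x = \<phi> y \<longleftrightarrow> x = y" if "x \<in> V" "y \<in> V" for x y
    using f that by (auto simp: \<phi>_def dest: inj_onD)
  have pad: "- 1 \<noteq> \<phi> x" for x by (simp add: \<phi>_def)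
  define p where "p j = (\<Prod>y\<in>B j. [:- \<phi> y, 1:])" for j
  \<comment> \<open>Sets with fewer than \<open>a\<close> elements are padded with copies of \<open>- 1\<close>, which is never a root of
    \<open>p j\<close> because \<open>\<phi>\<close> takes values in the natural numbers.\<close>
  define ts where "ts i = image_mset \<phi> (mset_set (A i)) + replicate_mset (a - card (A i)) (- 1)" for i
  define M where "M i j = (\<Prod>t\<in>#ts i. poly (p j) t)" for i j
  have poly_p: "poly (p j) t = (\<Prod>y\<in>B j. t - \<phi> y)" for j t
    by (simp add: p_def poly_prod)
  have "degree (p j) \<le> b" if "j < ?m" for j
  proof -
    have "degree (p j) \<le> (\<Sum>y\<in>B j. 1)"
      using degree_prod_sum_le[OF fin(2)[OF that], of "\<lambda>y. [:- \<phi> y, 1:]"]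
      by (simp add: p_def)
    then show ?thesis using card(2)[OF that] by simp
  qed
  then have eval_p: "poly (p j) t = (\<Sum>k\<le>b. coeff (p j) k * t ^ k)" if "j < ?m" for j t
    using that unfolding poly_altdef
    by (intro sum.mono_neutral_left) (auto simp: coeff_eq_0)
  have size_ts: "size (ts i) = a" if "i < ?m" for i
    using card(1)[OF that] by (simp add: ts_def)
  have M_0: "M i j = 0 \<longleftrightarrow> A i \<inter> B j \<noteq> {}" if "i < ?m" "j < ?m" for i j
  proof -
    have "poly (p j) (- 1) \<noteq> 0"
      using fin(2)[OF that(2)] pad by (simp add: poly_p)
    moreover have "poly (p j) (\<phi> x) = 0 \<longleftrightarrow> x \<in> B j" if "x \<in> A i" for x
    proof -
      have "\<phi> x = \<phi> y \<longleftrightarrow> x = y" if "y \<in> B j" for y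
        using inj[of x y] \<open>x \<in> A i\<close> that \<open>i < ?m\<close> \<open>j < ?m\<close> by (auto simp: V_def)
      then show ?thesis
        using fin(2)[OF \<open>j < ?m\<close>] by (auto simp: poly_p)
    qed
    moreover have "M i j = 0 \<longleftrightarrow> (\<exists>t\<in>#ts i. poly (p j) t = 0)"
      by (auto simp: M_def prod_mset_zero_iff)
    ultimately show ?thesis
      using fin(1)[OF that(1)] by (auto simp: ts_def split: if_splits)
  qed
  have "\<forall>i. \<exists>u. i < ?m \<longrightarrow> (\<forall>c. (\<Prod>t\<in>#ts i. \<Sum>k\<le>b. c k * t ^ k)
      = (\<Sum>K\<in>multisets_of_size {..b} a. u K * (\<Prod>k\<in>#K. c k)))"
    using prod_linear_forms_expansion[where b = b] size_ts by metis
  from choice[OF this] obtain u where u: "\<And>i c. i < ?m \<Longrightarrow> (\<Prod>t\<in>#ts i. \<Sum>k\<le>b. c k * t ^ k)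
      = (\<Sum>K\<in>multisets_of_size {..b} a. u i K * (\<Prod>k\<in>#K. c k))"
    by blast
  have "?m \<le> card (multisets_of_size {..b} a)"
  proof (rule triangular_factorization_bound[where M = M])
    show "M i j = (\<Sum>K\<in>multisets_of_size {..b} a. u i K * (\<Prod>k\<in>#K. coeff (p j) k))"
      if "i < ?m" "j < ?m" for i j
      unfolding M_def eval_p[OF that(2)] u[OF that(1)] ..
    show "M i i \<noteq> 0" if "i < ?m" for i
      using M_0[OF that that] disj[OF in_ps[OF that]] by simp
    show "M i j = 0" if "i < j" "j < ?m" for i j
      using M_0[of i j] meetAB[OF that] that by simp
  qed auto
  also have "\<dots> = (a + b) choose a"
    by (simp add: card_multisets_of_size add.commute)
  finally show ?thesis .
qed

section \<open>Exclusion sequences of intersecting families\<close>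

text \<open>
  When \<open>G\<close> consists of maximal intersecting families, a vertex \<open>A\<close> of an exclusion sequence is
  excluded by a family \<open>F\<close> because of an edge \<open>B\<close> of \<open>F\<close> disjoint from \<open>A\<close>; and \<open>B\<close>
  meets all previous vertices since they belong to \<open>F\<close>. The previous vertices come later in the
  list, which explains the direction of the relation.
\<close>

lemma exclusion_seq_witnesses:
  assumes "exclusion_seq G As"
    and "\<And>F A. F \<in> G \<Longrightarrow> A \<in> V \<Longrightarrow> A \<notin> F \<Longrightarrow> \<exists>B\<in>F. A \<inter> B = {}"
    and "\<And>F A B. F \<in> G \<Longrightarrow> A \<in> F \<Longrightarrow> B \<in> F \<Longrightarrow> A \<inter> B \<noteq> {}"
    and "set As \<subseteq> V"
  shows "\<exists>ps. map fst ps = As \<and> snd ` set ps \<subseteq> \<Union>G \<and> (\<forall>(A, B)\<in>set ps. A \<inter> B = {})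
    \<and> sorted_wrt (\<lambda>(A, B) (A', B'). A' \<inter> B \<noteq> {}) ps"
  using assms(1,4)
proof induction
  case Nil
  then show ?case by simp
next
  case (Cons As F A)
  then obtain ps where ps: "map fst ps = As" "snd ` set ps \<subseteq> \<Union>G"
      "\<forall>(A, B)\<in>set ps. A \<inter> B = {}" "sorted_wrt (\<lambda>(A, B) (A', B'). A' \<inter> B \<noteq> {}) ps"
    by auto
  obtain B where B: "B \<in> F" "A \<inter> B = {}"
    using assms(2)[of F A] Cons.hyps Cons.prems by auto
  have "A' \<inter> B \<noteq> {}" if "(A', B') \<in> set ps" for A' B'
  proof -
    have "A' \<in> set As" using that ps(1) by force
    then show ?thesis using assms(3) B(1) Cons.hyps by blast
  qed
  then show ?case
    using ps B Cons.hyps by (intro exI[of _ "(A, B) # ps"]) auto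
qed

text \<open>
  The face \<open>F\<close> containing the sequence makes its members meet pairwise, which is needed where
  the two copies of the list of pairs are joined.
\<close>

lemma exclusion_seq_intersecting_bound:
  assumes "exclusion_seq G As" and F: "F \<in> G" "set As \<subseteq> F"
    and avoid: "\<And>F A. F \<in> G \<Longrightarrow> A \<in> V \<Longrightarrow> A \<notin> F \<Longrightarrow> \<exists>B\<in>F. A \<inter> B = {}"
    and intersecting: "\<And>F A B. F \<in> G \<Longrightarrow> A \<in> F \<Longrightarrow> B \<in> F \<Longrightarrow> A \<inter> B \<noteq> {}"
    and cover: "\<Union>G \<subseteq> V"
    and size: "\<And>A. A \<in> V \<Longrightarrow> finite A \<and> card A \<le> r"
  shows "2 * length As \<le> 2 * r choose r"
proof -
  have V: "set As \<subseteq> V" using F cover by blast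
  obtain ps where ps: "map fst ps = As" "snd ` set ps \<subseteq> \<Union>G"
      "\<forall>(A, B)\<in>set ps. A \<inter> B = {}" "sorted_wrt (\<lambda>(A, B) (A', B'). A' \<inter> B \<noteq> {}) ps"
  proof -
    have "\<exists>ps. map fst ps = As \<and> snd ` set ps \<subseteq> \<Union>G \<and> (\<forall>(A, B)\<in>set ps. A \<inter> B = {})
      \<and> sorted_wrt (\<lambda>(A, B) (A', B'). A' \<inter> B \<noteq> {}) ps"
      by (rule exclusion_seq_witnesses[OF assms(1)]) (fact avoid intersecting V)+
    then show ?thesis using that by blast
  qed
  let ?qs = "rev ps @ map prod.swap ps"
  have As: "A \<in> set As" if "(A, B) \<in> set ps" for A B using that ps(1) by force
  have Bs: "B \<in> V" if "(A, B) \<in> set ps" for A B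
  proof -
    have "B \<in> snd ` set ps" using that by (rule rev_image_eqI) simp
    then show ?thesis using ps(2) cover by blast
  qed
  have "length ?qs \<le> (r + r) choose r"
  proof (rule skew_Bollobas)
    have "sorted_wrt (\<lambda>p q. fst q \<inter> snd p \<noteq> {}) ps"
      by (rule sorted_wrt_mono_rel[OF _ ps(4)]) auto
    moreover have "fst p \<inter> fst q \<noteq> {}" if "p \<in> set ps" "q \<in> set ps" for p q
      using intersecting[OF F(1), of "fst p" "fst q"] F(2) As[of "fst p" "snd p"]
        As[of "fst q" "snd q"] that by auto
    ultimately have "sorted_wrt (\<lambda>p q. fst p \<inter> snd q \<noteq> {}) ?qs"
      by (auto simp: sorted_wrt_append sorted_wrt_rev sorted_wrt_map Int_commute)
    then show "sorted_wrt (\<lambda>(A, B) (A', B'). A \<inter> B' \<noteq> {}) ?qs"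
      by (rule sorted_wrt_mono_rel[rotated]) auto
    show "A \<inter> B = {}" if "(A, B) \<in> set ?qs" for A B
      using that ps(3) by auto
    show "finite A \<and> card A \<le> r \<and> finite B \<and> card B \<le> r" if "(A, B) \<in> set ?qs" for A B
    proof -
      have "A \<in> V \<and> B \<in> V" using that As Bs V by auto
      then show ?thesis using size by blast
    qed
  qed
  moreover have "length ps = length As" using ps(1) by auto
  ultimately show ?thesis by (simp add: mult_2)
qed

theorem theorem1p3:
  fixes H :: "'a set set" and r :: nat
  assumes "finite_hypergraph H"
    and "hypergraph_rank H = r"
  shows "collapsible ((2 * r choose r) div 2) (Int_complex H)"
proof -
  let ?X = "Int_complex H"
  have finH: "finite H" and fin_edge: "\<And>A. A \<in> H \<Longrightarrow> finite A"
    using assms(1) by (auto simp: finite_hypergraph_def)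
  have rank: "card A \<le> r" if "A \<in> H" for A
    using assms(2) finH that by (auto simp: hypergraph_rank_def intro: Max_ge)
  \<comment> \<open>The empty edge lies in no intersecting family. It must be left out because the family \<open>{}\<close>,
    when it is maximal, contains no edge that could witness the absence of the empty edge.\<close>
  define V where "V = {A \<in> H. A \<noteq> {}}"
  define G where "G = {F. maximal_face ?X F}"
  have XH: "?X \<subseteq> Pow H" by (auto simp: Int_complex_def)
  then have finX: "finite ?X" using finH finite_Pow_iff finite_subset by metis
  have G: "F \<subseteq> V" "F \<in> ?X" if "F \<in> G" for F
    using that by (auto simp: G_def V_def maximal_face_def Int_complex_def)
  have avoid: "\<exists>B\<in>F. A \<inter> B = {}" if F: "F \<in> G" and A: "A \<in> V" "A \<notin> F" for F A
  proof (rule ccontr)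
    assume "\<not> (\<exists>B\<in>F. A \<inter> B = {})"
    then have "insert A F \<in> ?X"
      using A G(2)[OF F] by (auto simp: Int_complex_def V_def)
    then show False
      using F A(2) by (auto simp: G_def maximal_face_def)
  qed
  show ?thesis
  proof (rule collapsible_if_exclusion_seq_bounded)
    show "finite G"
      by (rule finite_subset[OF _ finX]) (use G in blast)
    show "finite F" if "F \<in> G" for F
      using G(2)[OF that] XH finH finite_subset by blast
    show "?X = {\<sigma>. \<exists>F\<in>G. \<sigma> \<subseteq> F}"
    proof (intro equalityI subsetI)
      fix \<sigma> assume "\<sigma> \<in> ?X"
      then obtain F where "F \<in> ?X" "\<sigma> \<subseteq> F" "\<And>\<rho>. \<rho> \<in> ?X \<Longrightarrow> F \<subseteq> \<rho> \<Longrightarrow> F = \<rho>"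
        using finite_has_maximal2[OF finX, of \<sigma>] by auto
      then show "\<sigma> \<in> {\<sigma>. \<exists>F\<in>G. \<sigma> \<subseteq> F}"
        by (auto simp: G_def maximal_face_def)
    next
      fix \<sigma> assume "\<sigma> \<in> {\<sigma>. \<exists>F\<in>G. \<sigma> \<subseteq> F}"
      then obtain F where "F \<in> ?X" "\<sigma> \<subseteq> F" using G(2) by blast
      then show "\<sigma> \<in> ?X" unfolding Int_complex_def by blast
    qed
    fix As F assume "exclusion_seq G As" and F: "F \<in> G" "set As \<subseteq> F"
    then have "2 * length As \<le> 2 * r choose r"
    proof (rule exclusion_seq_intersecting_bound[where V = V])
      show "A \<inter> B \<noteq> {}" if "F \<in> G" "A \<in> F" "B \<in> F" for F A B
        using G(2)[OF that(1)] that(2,3) by (auto simp: Int_complex_def)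
      show "finite A \<and> card A \<le> r" if "A \<in> V" for A
        using that fin_edge rank by (auto simp: V_def)
    qed (use avoid G in auto)
    then show "length As \<le> (2 * r choose r) div 2" by linarith
  qed
qed

end
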